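(* Let $\mathcal{S}_0$ be a set of stakeholders, each $s\in\mathcal{S}_0$ with an argumentation theory $\mathcal{N}_s=(\mathcal{L},\overline{\,\cdot\,},\mathcal{R}_s,\mathcal{K})$. Given the set of individual argumentation frameworks $\{AF(\mathcal{N}_s)\mid s\in\mathcal{S}_0\}$, where $AF(\mathcal{N}_s)=(\mathit{Arg}(\mathcal{N}_s),\mathit{Def}(\mathcal{N}_s))$, and the combined argumentation framework $AF(\mathcal{S}_0)=(\mathit{Arg}(\mathcal{S}_0),\mathit{Def}(\mathcal{S}_0))$, it holds that $\mathit{Def}(\mathcal{S}_0)\supseteq\bigcup_{s\in\mathcal{S}_0}\mathit{Def}(\mathcal{N}_s)$.
   Context: Language and norms. Fix a set $\mathit{Var}$ of propositional atoms and a language $\mathcal{L}$ with $\mathit{Var}\subseteq\mathcal{L}\subseteq \mathit{Var}\cup\{\neg p: p\in\mathit{Var}\}$. A contrariness function is a (partial) map $\overline{\,\cdot\,}:\mathcal{L}\to 2^{\mathcal{L}}$, not necessarily symmetric, with $\varphi\in\overline{\neg\varphi}$ and $\neg\varphi\in\overline{\varphi}$ for every $\neg\varphi\in\mathcal{L}$. A norm of stakeholder $s$ is an expression $\phi_1,\dots,\phi_n\Rightarrow^\tau_s\phi$ with $\phi_i,\phi\in\mathcal{L}$ and type $\tau\in\{c,r,p\}$ (constitutive, regulative, permissive). An argumentation theory of $s$ is $\mathcal{N}_s=(\mathcal{L},\overline{\,\cdot\,},\mathcal{R}_s,\mathcal{K})$ with $\mathcal{R}_s$ a set of norms of $s$ and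 $\mathcal{K}\subseteq\mathcal{L}$ (the context, or brute facts); the language, contrariness function and context are shared by all stakeholders. Arguments. Over a theory with norms $\mathcal{R}$ and context $\mathcal{K}$, arguments are built inductively, with a conclusion $\mathrm{Conc}$: (1) $\{\phi\}$ for $\phi\in\mathcal{K}$ (brute fact argument), conclusion $\phi$; (2) if $A_1,\dots,A_n$ are brute or institutional fact arguments and $\mathrm{Conc}(A_1),\dots,\mathrm{Conc}(A_n)\Rightarrow^\tau_s\phi$ is a norm in $\mathcal{R}$, then $A_1,\dots,A_n\Rightarrow^\tau_s\phi$ is an argument with conclusion $\phi$, called an institutional fact argument if $\tau=c$, an obligation argument if $\tau=r$, and a permission argument if $\tau=p$. $\mathcal{A}^b,\mathcal{A}^c,\mathcal{A}^r,\mathcal{A}^p$ are the sets of brute fact, institutional fact, obligation and permission arguments. $\mathrm{Sub}(A)$ consists of $A$ and all subarguments of its immediate constituents $A_i$. $\mathit{Arg}(\mathcal{N}_s)$ is the set of arguments built from $\mathcal{N}_s$. Priority and defeat. The relation $\succeq$ on a set of arguments is the one in which: $A\succeq B$ for $A,B\in\mathcal{A}^\tau$ with the same $\tau\in\{b,c,r\}$; $A\succ B$ for $A\in\mathcal{A}^b$, $B\in\mathcal{A}^c\cup\mathcal{A}^r$; $A\succ B$ for $A\in\mathcal{A}^c$, $B\in\mathcal{A}^r$; $A\succ B$ for $A\in\mathcal{A}^p$, $B\in\mathcal{A}^r$; no other pairs are related. Here $A\succ B$ means $A\succeq B$ and $B\not\succeq A$, and $B\prec A$ means $A\succ B$. $A$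 attacks $B$ at $B'$ iff $B'\in\mathrm{Sub}(B)$ and $\mathrm{Conc}(A)\in\overline{\mathrm{Conc}(B')}$. $A$ defeats $B$ iff either $A$ attacks $B$ at some $B'$ with $A\succeq B'$, or some $B'\in\mathrm{Sub}(B)$ attacks $A$ at $A$ and $B'\prec A$. $\mathit{Def}(\mathcal{N}_s)$ is the defeat relation on $\mathit{Arg}(\mathcal{N}_s)$. Combined framework. $\mathit{Arg}(\mathcal{S}_0)=\bigcup_{s\in\mathcal{S}_0}\mathit{Arg}(\mathcal{N}_s)$, $\mathit{Def}(\mathcal{S}_0)$ is the defeat relation on the set $\mathit{Arg}(\mathcal{S}_0)$, and $AF(\mathcal{S}_0)=(\mathit{Arg}(\mathcal{S}_0),\mathit{Def}(\mathcal{S}_0))$. *)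

theory Defs
  imports Main
begin

datatype 'v lit = Pos 'v | Neg 'v

definition is_language :: "'v set \<Rightarrow> 'v lit set \<Rightarrow> bool" where
  "is_language Var L \<longleftrightarrow> Pos ` Var \<subseteq> L \<and> L \<subseteq> Pos ` Var \<union> Neg ` Var"

text \<open>A contrariness function is partial; a literal outside its domain has no contraries.\<close>

definition contraries :: "('v lit \<rightharpoonup> 'v lit set) \<Rightarrow> 'v lit \<Rightarrow> 'v lit set" where
  "contraries bar \<phi> = (case bar \<phi> of None \<Rightarrow> {} | Some C \<Rightarrow> C)"

definition is_contrariness :: "'v lit set \<Rightarrow> ('v lit \<rightharpoonup> 'v lit set) \<Rightarrow> bool" where
  "is_contrariness L bar \<longleftrightarrow>
     dom bar \<subseteq> L \<and> (\<forall>C\<in>ran bar. C \<subseteq> L) \<and>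
     (\<forall>p. Neg p \<in> L \<longrightarrow>
        Pos p \<in> contraries bar (Neg p) \<and> Neg p \<in> contraries bar (Pos p))"

datatype norm_type = Constitutive | Regulative | Permissive

datatype ('v, 's) norm =
  Norm (body: "'v lit list") (ntype: norm_type) (holder: 's) (head: "'v lit")

record ('v, 's) arg_theory =
  lang :: "'v lit set"
  contr :: "'v lit \<rightharpoonup> 'v lit set"
  norms :: "('v, 's) norm set"
  brute_facts :: "'v lit set"

definition is_arg_theory :: "'v set \<Rightarrow> 's \<Rightarrow> ('v, 's) arg_theory \<Rightarrow> bool" where
  "is_arg_theory Var s N \<longleftrightarrow>
     is_language Var (lang N) \<and>
     is_contrariness (lang N) (contr N) \<and>
     (\<forall>r\<in>norms N. holder r = s \<and> set (body r) \<subseteq> lang N \<and> head r \<in> lang N) \<and>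
     brute_facts N \<subseteq> lang N"

text \<open>
  Raw argument trees. \<open>Apply As \<tau> s \<phi>\<close> stands for \<open>A\<^sub>1, \<dots>, A\<^sub>n \<Rightarrow> \<phi>\<close> labelled with type
  \<open>\<tau>\<close> and stakeholder \<open>s\<close>; the trees that a theory really licenses form the set \<open>Arg\<close> below.
\<close>

datatype ('v, 's) argument =
    Brute "'v lit"
  | Apply "('v, 's) argument list" norm_type 's "'v lit"

fun Conc :: "('v, 's) argument \<Rightarrow> 'v lit" where
  "Conc (Brute \<phi>) = \<phi>"
| "Conc (Apply As \<tau> s \<phi>) = \<phi>"

fun Sub :: "('v, 's) argument \<Rightarrow> ('v, 's) argument set" where
  "Sub (Brute \<phi>) = {Brute \<phi>}"
| "Sub (Apply As \<tau> s \<phi>) = insert (Apply As \<tau> s \<phi>) (\<Union>A\<in>set As. Sub A)"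

datatype arg_kind = Brute_Fact | Institutional_Fact | Obligation | Permission

fun kind :: "('v, 's) argument \<Rightarrow> arg_kind" where
  "kind (Brute \<phi>) = Brute_Fact"
| "kind (Apply As Constitutive s \<phi>) = Institutional_Fact"
| "kind (Apply As Regulative s \<phi>) = Obligation"
| "kind (Apply As Permissive s \<phi>) = Permission"

inductive_set Arg :: "('v, 's) arg_theory \<Rightarrow> ('v, 's) argument set"
  for N :: "('v, 's) arg_theory" where
  brute: "\<phi> \<in> brute_facts N \<Longrightarrow> Brute \<phi> \<in> Arg N"
| apply_norm:
    "\<lbrakk>\<And>A. A \<in> set As \<Longrightarrow> A \<in> Arg N;
      \<And>A. A \<in> set As \<Longrightarrow> kind A = Brute_Fact \<or> kind A = Institutional_Fact;
      Norm (map Conc As) \<tau> s \<phi> \<in> norms N\<rbrakk>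
     \<Longrightarrow> Apply As \<tau> s \<phi> \<in> Arg N"

definition of_kind :: "('v, 's) argument set \<Rightarrow> arg_kind \<Rightarrow> ('v, 's) argument set" where
  "of_kind X k = {A \<in> X. kind A = k}"

text \<open>
  The priority relation on a set \<open>X\<close> of arguments contains exactly the listed pairs. In
  particular it is not reflexive on permission arguments. The clauses between different
  kinds are the strict ones, see \<open>strict_priority_iff\<close>.
\<close>

definition priority :: "('v, 's) argument set \<Rightarrow> ('v, 's) argument \<Rightarrow> ('v, 's) argument \<Rightarrow> bool" where
  "priority X A B \<longleftrightarrow>
     (\<exists>k\<in>{Brute_Fact, Institutional_Fact, Obligation}. A \<in> of_kind X k \<and> B \<in> of_kind X k) \<or>
     A \<in> of_kind X Brute_Fact \<and> B \<in> of_kind X Institutional_Fact \<union> of_kind X Obligation \<or>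
     A \<in> of_kind X Institutional_Fact \<and> B \<in> of_kind X Obligation \<or>
     A \<in> of_kind X Permission \<and> B \<in> of_kind X Obligation"

definition strict_priority ::
  "('v, 's) argument set \<Rightarrow> ('v, 's) argument \<Rightarrow> ('v, 's) argument \<Rightarrow> bool" where
  "strict_priority X A B \<longleftrightarrow> priority X A B \<and> \<not> priority X B A"

lemma strict_priority_iff:
  "strict_priority X A B \<longleftrightarrow>
     A \<in> of_kind X Brute_Fact \<and> B \<in> of_kind X Institutional_Fact \<union> of_kind X Obligation \<or>
     A \<in> of_kind X Institutional_Fact \<and> B \<in> of_kind X Obligation \<or>
     A \<in> of_kind X Permission \<and> B \<in> of_kind X Obligation"
  by (auto simp: strict_priority_def priority_def of_kind_def)

definition attacks_at :: "('v lit \<rightharpoonup> 'v lit set) \<Rightarrow>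
    ('v, 's) argument \<Rightarrow> ('v, 's) argument \<Rightarrow> ('v, 's) argument \<Rightarrow> bool" where
  "attacks_at bar A B B' \<longleftrightarrow> B' \<in> Sub B \<and> Conc A \<in> contraries bar (Conc B')"

definition defeats :: "('v lit \<rightharpoonup> 'v lit set) \<Rightarrow> ('v, 's) argument set \<Rightarrow>
    ('v, 's) argument \<Rightarrow> ('v, 's) argument \<Rightarrow> bool" where
  "defeats bar X A B \<longleftrightarrow>
     (\<exists>B'. attacks_at bar A B B' \<and> priority X A B') \<or>
     (\<exists>B'\<in>Sub B. attacks_at bar B' A A \<and> strict_priority X A B')"

definition defeat_relation :: "('v lit \<rightharpoonup> 'v lit set) \<Rightarrow> ('v, 's) argument set \<Rightarrow>
    (('v, 's) argument \<times> ('v, 's) argument) set" where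
  "defeat_relation bar X = {(A, B). A \<in> X \<and> B \<in> X \<and> defeats bar X A B}"

definition Def :: "('v, 's) arg_theory \<Rightarrow> (('v, 's) argument \<times> ('v, 's) argument) set" where
  "Def N = defeat_relation (contr N) (Arg N)"

definition combined_Arg :: "('s \<Rightarrow> ('v, 's) arg_theory) \<Rightarrow> 's set \<Rightarrow> ('v, 's) argument set" where
  "combined_Arg N S0 = (\<Union>s\<in>S0. Arg (N s))"

text \<open>The argument \<open>bar\<close> is the contrariness function shared by all stakeholders.\<close>

definition combined_Def :: "('v lit \<rightharpoonup> 'v lit set) \<Rightarrow> ('s \<Rightarrow> ('v, 's) arg_theory) \<Rightarrow> 's set \<Rightarrow>
    (('v, 's) argument \<times> ('v, 's) argument) set" where
  "combined_Def bar N S0 = defeat_relation bar (combined_Arg N S0)"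

end

theory Submission
  imports Defs
begin

lemma of_kind_mono: "X \<subseteq> Y \<Longrightarrow> of_kind X k \<subseteq> of_kind Y k"
  by (auto simp: of_kind_def)

text \<open>Each clause uses membership in \<open>of_kind\<close> only positively.\<close>

lemma priority_mono: "X \<subseteq> Y \<Longrightarrow> priority X A B \<Longrightarrow> priority Y A B"
  unfolding priority_def using of_kind_mono[of X Y] by blast

text \<open>
  Monotone although its definition negates \<open>priority\<close>: whether the converse pair is related
  depends only on the kinds of the two arguments, not on the set they are taken from.
\<close>

lemma strict_priority_mono: "X \<subseteq> Y \<Longrightarrow> strict_priority X A B \<Longrightarrow> strict_priority Y A B"
  unfolding strict_priority_iff using of_kind_mono[of X Y] by blast

text \<open>Attacks and \<open>Sub\<close> do not refer to the ambient set; it enters only through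
  membership and the two priority relations, all of which survive enlarging it.\<close>

lemma defeat_relation_mono: "X \<subseteq> Y \<Longrightarrow> defeat_relation bar X \<subseteq> defeat_relation bar Y"
  unfolding defeat_relation_def defeats_def
  using priority_mono[of X Y] strict_priority_mono[of X Y] by blast

theorem fact5p2:
  fixes Var :: "'v set"
    and L :: "'v lit set"
    and bar :: "'v lit \<rightharpoonup> 'v lit set"
    and R :: "'s \<Rightarrow> ('v, 's) norm set"
    and K :: "'v lit set"
    and N :: "'s \<Rightarrow> ('v, 's) arg_theory"
    and S0 :: "'s set"
  assumes "\<And>s. s \<in> S0 \<Longrightarrow> N s = \<lparr>lang = L, contr = bar, norms = R s, brute_facts = K\<rparr>"
    and "\<And>s. s \<in> S0 \<Longrightarrow> is_arg_theory Var s (N s)"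
  shows "combined_Def bar N S0 \<supseteq> (\<Union>s\<in>S0. Def (N s))"
proof (rule UN_least)
  fix s assume s: "s \<in> S0"
  \<comment> \<open>Because contrariness is shared, both sides are
    \<open>defeat_relation bar\<close>, taken on nested sets of arguments.\<close>
  then have "contr (N s) = bar" by (simp add: assms(1))
  moreover have "Arg (N s) \<subseteq> combined_Arg N S0"
    using s by (auto simp: combined_Arg_def)
  ultimately show "Def (N s) \<subseteq> combined_Def bar N S0"
    unfolding Def_def combined_Def_def by (simp add: defeat_relation_mono)
qed

end
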